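(* Let $r\ge 2$ and let $\mathbf{a}=(a_1,\dots,a_r)$ be an $r$-tuple of positive integers which are pairwise coprime. For each integer $n\ge 2$ let $\mathbf{X}^{(n)}=(X^{(n)}_1,\dots,X^{(n)}_r)$, where the $X^{(n)}_j$ are independent random variables uniformly distributed in $\{1,\dots,n\}$. Then: (a) $$\lim_{n\to\infty}\mathbf{P}\big(\mathbf{X}^{(n)}\in\mathcal{PC}^{\mathbf{a}}\big)=T_r\,\frac{1}{\Psi_{r-1}(|\mathbf{a}|)}.$$ (b) $$\lim_{n\to\infty}\mathbf{P}\big(\mathbf{X}^{(n)}\in\mathcal{C}^{\mathbf{a}}\big)=\frac{1}{\zeta(r)}\,\frac{\varphi_{r-1}(|\mathbf{a}|)}{\varphi_r(|\mathbf{a}|)}.$$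
   Context: $|\mathbf{a}|=a_1a_2\cdots a_r$. $\mathcal{PC}^{\mathbf{a}}$ is the set of $r$-tuples $\mathbf{x}=(x_1,\dots,x_r)$ of positive integers such that $\gcd(x_i,x_j)=1$ for all $i\neq j$ (pairwise coprime) and $a_i\mid x_i$ for all $i=1,\dots,r$. $\mathcal{C}^{\mathbf{a}}$ is the set of $r$-tuples $\mathbf{x}$ of positive integers such that $\gcd(x_1,\dots,x_r)=1$ (mutually coprime) and $a_i\mid x_i$ for all $i=1,\dots,r$. $T_r=\prod_p\big((1-\frac1p)^r+\frac rp(1-\frac1p)^{r-1}\big)$, the product being over all primes $p$. $\zeta$ is the Riemann zeta function. For each integer $s$, $\Psi_s(1)=1$ and $\Psi_s(a)=a\prod_{p\mid a}(1+\frac sp)$ for integers $a>1$ (product over primes $p$ dividing $a$). For each integer $s\ge1$ the Jordan totient function is $\varphi_s(1)=1$, $\varphi_s(a)=a^s\prod_{p\mid a}(1-\frac1{p^s})$ for $a>1$. *)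

theory Defs
  imports "HOL-Probability.Probability" "HOL-Computational_Algebra.Primes"
begin

text \<open>
  An \<open>r\<close>-tuple of natural numbers is an extensional function on the index set \<open>{1..r}\<close>, that is,
  an element of \<open>{1..r} \<rightarrow>\<^sub>E UNIV\<close>.
\<close>

definition pairwise_coprime_tuples :: "nat \<Rightarrow> (nat \<Rightarrow> nat) \<Rightarrow> (nat \<Rightarrow> nat) set" where
  "pairwise_coprime_tuples r a =
     {x \<in> {1..r} \<rightarrow>\<^sub>E {0<..}.
        (\<forall>i\<in>{1..r}. \<forall>j\<in>{1..r}. i \<noteq> j \<longrightarrow> gcd (x i) (x j) = 1) \<and>
        (\<forall>i\<in>{1..r}. a i dvd x i)}"

definition coprime_tuples :: "nat \<Rightarrow> (nat \<Rightarrow> nat) \<Rightarrow> (nat \<Rightarrow> nat) set" where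
  "coprime_tuples r a =
     {x \<in> {1..r} \<rightarrow>\<^sub>E {0<..}. Gcd (x ` {1..r}) = 1 \<and> (\<forall>i\<in>{1..r}. a i dvd x i)}"

text \<open>
  The product over all primes is taken in increasing order, with factor 1 at the non-primes.
  Its convergence is shown in \<open>convergent_prod_T_const\<close> below, so \<open>prodinf\<close> is meaningful here.
\<close>

definition T_const :: "nat \<Rightarrow> real" where
  "T_const r =
     (\<Prod>p. if prime p
           then (1 - 1 / real p) ^ r + real r / real p * (1 - 1 / real p) ^ (r - 1)
           else 1)"

text \<open>The Riemann zeta function on its half-line of convergence \<open>s > 1\<close>; junk for \<open>s \<le> 1\<close>.\<close>

definition zeta :: "real \<Rightarrow> real" where
  "zeta s = (\<Sum>n. 1 / real (Suc n) powr s)"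

text \<open>For \<open>a = 1\<close> the products below are empty, so both functions take the value 1 there.\<close>

definition Psi :: "int \<Rightarrow> nat \<Rightarrow> real" where
  "Psi s a = real a * (\<Prod>p\<in>prime_factors a. 1 + of_int s / real p)"

definition jordan_totient :: "nat \<Rightarrow> nat \<Rightarrow> real" where
  "jordan_totient s a = real a ^ s * (\<Prod>p\<in>prime_factors a. 1 - 1 / real p ^ s)"

lemma summable_zeta:
  assumes "s > 1"
  shows "summable (\<lambda>n. 1 / real (Suc n) powr s)"
proof -
  have "summable (\<lambda>n. real n powr (-s))"
    using assms by (simp add: summable_real_powr_iff)
  then have "summable (\<lambda>n. real (Suc n) powr (-s))"
    by (subst summable_Suc_iff)
  then show ?thesis
    by (simp add: powr_minus_divide)
qed

lemma T_const_factor_bound: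
  fixes h :: real
  assumes "0 \<le> h" "h \<le> 1"
  shows "\<bar>(1 - h) ^ r + real r * h * (1 - h) ^ (r - 1) - 1\<bar> \<le> real r ^ 2 * h ^ 2"
proof (induction r)
  case 0
  then show ?case by simp
next
  case (Suc r)
  let ?P = "\<lambda>r. (1 - h) ^ r + real r * h * (1 - h) ^ (r - 1) - 1"
  have step: "?P (Suc r) = ?P r - real r * h ^ 2 * (1 - h) ^ (r - 1)"
    by (cases r) (simp_all add: algebra_simps power2_eq_square)
  have "\<bar>real r * h ^ 2 * (1 - h) ^ (r - 1)\<bar> \<le> real r * h ^ 2 * 1"
    unfolding abs_mult using assms
    by (intro mult_mono) (auto simp: power_le_one)
  then have "\<bar>?P (Suc r)\<bar> \<le> real r ^ 2 * h ^ 2 + real r * h ^ 2"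
    using Suc step by linarith
  also have "\<dots> \<le> real (Suc r) ^ 2 * h ^ 2"
    using assms by (simp add: algebra_simps power2_eq_square)
  finally show ?case .
qed

lemma convergent_prod_T_const:
  "convergent_prod (\<lambda>p. if prime p
     then (1 - 1 / real p) ^ r + real r / real p * (1 - 1 / real p) ^ (r - 1)
     else 1)" (is "convergent_prod ?f")
proof -
  have "summable (\<lambda>p. norm (?f p - 1))"
  proof (rule summable_comparison_test')
    show "summable (\<lambda>p. real r ^ 2 * inverse (real p ^ 2))"
      by (intro summable_mult inverse_power_summable) simp
    show "norm (norm (?f p - 1)) \<le> real r ^ 2 * inverse (real p ^ 2)" if "p \<ge> 0" for p
      using T_const_factor_bound[of "1 / real p" r] prime_gt_0_nat[of p]
      by (auto simp: field_simps)
  qed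
  then show ?thesis
    by (intro abs_convergent_prod_imp_convergent_prod summable_imp_abs_convergent_prod)
qed

end

theory Submission
  imports Defs
begin

text \<open>
  Both sets are described by local conditions: besides the divisibilities \<open>a i dvd x i\<close>, the pattern
  \<open>{i. p dvd x i}\<close> must for every prime \<open>p\<close> lie in a family \<open>F\<close>, namely the sets with at most one
  element for pairwise coprimality and the proper subsets of \<open>{1..r}\<close> for mutual coprimality. For
  finitely many primes the indicator of the condition is a sum of products of functions of a single
  coordinate, so its density is a product of local weights. A tuple violating the condition at
  a prime \<open>p\<close> has two coordinates divisible by \<open>p\<close>, so the primes above \<open>N\<close> only contribute
  \<open>O(1 / N)\<close>, uniformly in \<open>n\<close>, and the limit may be taken over the primes.
\<close>

section \<open>Averages over one coordinate under divisibility conditions\<close>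

lemma prod_of_bool: "finite A \<Longrightarrow> (\<Prod>x\<in>A. of_bool (P x)) = (of_bool (\<forall>x\<in>A. P x) :: 'a :: comm_semiring_1)"
  by (induction A rule: finite_induct) auto

lemma card_multiples:
  fixes d n :: nat
  assumes "d > 0"
  shows "card {x \<in> {1..n}. d dvd x} = n div d"
proof -
  have "{x \<in> {1..n}. d dvd x} = (\<lambda>k. d * k) ` {1..n div d}"
    using assms by (fastforce simp: dvd_def less_eq_div_iff_mult_less_eq mult.commute)
  moreover have "inj_on (\<lambda>k. d * k) {1..n div d}"
    using assms by (auto simp: inj_on_def)
  ultimately show ?thesis
    by (simp add: card_image)
qed

text \<open>The count is \<open>n div d\<close>, which differs from \<open>n / d\<close> by less
  than 1, so the quotient is squeezed between \<open>1 / d - 1 / n\<close> and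
  \<open>1 / d\<close>.\<close>

lemma tendsto_density_multiples:
  fixes d :: nat
  assumes "d > 0"
  shows "(\<lambda>n. (\<Sum>x=1..n. of_bool (d dvd x)) / real n) \<longlonglongrightarrow> 1 / real d"
proof -
  have eq: "(\<Sum>x=1..n. of_bool (d dvd x)) = real (n div d)" for n
    using card_multiples[OF assms, of n] by (simp add: Int_def)
  show ?thesis
  proof (rule tendsto_sandwich)
    show "\<forall>\<^sub>F n in sequentially. 1 / real d - 1 / real n \<le> (\<Sum>x=1..n. of_bool (d dvd x)) / real n"
    proof (intro eventually_sequentiallyI[of 1])
      fix n :: nat assume n: "1 \<le> n"
      have "real n / real d - 1 \<le> real (n div d)"
        using floor_divide_of_nat_eq[of n d, where 'a = real] by linarith
      then have "(real n / real d - 1) / real n \<le> real (n div d) / real n"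
        by (rule divide_right_mono) simp
      then show "1 / real d - 1 / real n \<le> (\<Sum>x=1..n. of_bool (d dvd x)) / real n"
        unfolding eq using n by (simp add: diff_divide_distrib)
    qed
    show "\<forall>\<^sub>F n in sequentially. (\<Sum>x=1..n. of_bool (d dvd x)) / real n \<le> 1 / real d"
    proof (intro eventually_sequentiallyI[of 1])
      fix n :: nat assume n: "1 \<le> n"
      have "real (n div d) \<le> real n / real d"
        by (rule of_nat_div_le_of_nat)
      then show "(\<Sum>x=1..n. of_bool (d dvd x)) / real n \<le> 1 / real d"
        unfolding eq using n assms by (simp add: field_simps)
    qed
    have "(\<lambda>n. 1 / real d - 1 / real n) \<longlonglongrightarrow> 1 / real d - 0"
      by (intro tendsto_intros lim_1_over_n)
    then show "(\<lambda>n. 1 / real d - 1 / real n) \<longlonglongrightarrow> 1 / real d"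
      by simp
  qed auto
qed

text \<open>Induction on \<open>P\<close>: a function of a truth value is affine,
  \<open>g p b = g p False + of_bool b * (g p True - g p False)\<close>, and the conditions
  \<open>d dvd x\<close> and \<open>p dvd x\<close> merge into \<open>lcm d p dvd x\<close>. The
  modulus changes, so \<open>d\<close> has to vary in the induction. In the limit, \<open>u\<close>
  is the density of the multiples of \<open>p\<close> among the multiples of
  \<open>d\<close>.\<close>

lemma tendsto_average_multiples_prod:
  fixes d :: nat and g :: "nat \<Rightarrow> bool \<Rightarrow> real"
  assumes "finite P" "\<And>p. p \<in> P \<Longrightarrow> prime p" "d > 0"
  shows "(\<lambda>n. (\<Sum>x=1..n. of_bool (d dvd x) * (\<Prod>p\<in>P. g p (p dvd x))) / real n) \<longlonglongrightarrow>
    1 / real d * (\<Prod>p\<in>P. let u = (if p dvd d then 1 else 1 / real p) in u * g p True + (1 - u) * g p False)"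
  using assms
proof (induction P arbitrary: d rule: finite_induct)
  case empty
  then show ?case
    using tendsto_density_multiples[of d] by simp
next
  case (insert p P)
  define L where "L d = 1 / real d * (\<Prod>p\<in>P. let u = (if p dvd d then 1 else 1 / real p) in u * g p True + (1 - u) * g p False)" for d
  define s where "s d n = (\<Sum>x=1..n. of_bool (d dvd x) * (\<Prod>p\<in>P. g p (p dvd x)))" for d n
  define u where "u = (if p dvd d then 1 else 1 / real p)"
  have p: "prime p" "p > 0"
    using insert.prems prime_gt_0_nat by auto
  have lim: "(\<lambda>n. s d n / real n) \<longlonglongrightarrow> L d" if "d > 0" for d
    unfolding s_def L_def using insert that by auto
  have pos: "lcm d p > 0"
    using insert.prems p by (simp add: lcm_pos_nat)
  \<comment> \<open>Replacing \<open>d\<close> by \<open>lcm d p\<close> must not disturb the local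
    factors at the primes of \<open>P\<close>, all of which differ from \<open>p\<close>.\<close>
  have dvd_lcm: "q dvd lcm d p \<longleftrightarrow> q dvd d" if "q \<in> P" for q
  proof -
    have q: "prime q" "q \<noteq> p"
      using insert that by auto
    have "\<not> q dvd p"
      using q p primes_dvd_imp_eq by blast
    moreover have "lcm d p dvd d * p"
      by (intro lcm_least) auto
    ultimately show ?thesis
      using q by (meson dvd_lcm1 dvd_trans prime_dvd_mult_iff)
  qed
  have L_lcm: "L (lcm d p) = u * L d"
  proof -
    have "1 / real (lcm d p) = u * (1 / real d)"
    proof (cases "p dvd d")
      case True
      then show ?thesis by (simp add: u_def lcm_proj1_iff_nat)
    next
      case False
      then have "coprime d p"
        using p by (metis prime_imp_coprime coprime_commute)
      then show ?thesis
        using False by (simp add: u_def lcm_coprime)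
    qed
    then show ?thesis
      unfolding L_def using dvd_lcm by (simp cong: prod.cong)
  qed
  have split: "s d n * g p False + s (lcm d p) n * (g p True - g p False) =
      (\<Sum>x=1..n. of_bool (d dvd x) * (\<Prod>p\<in>insert p P. g p (p dvd x)))" for n
    unfolding s_def sum_distrib_right sum.distrib[symmetric] using insert.hyps
    by (intro sum.cong) (auto simp: algebra_simps)
  have "(\<lambda>n. s d n / real n * g p False + s (lcm d p) n / real n * (g p True - g p False))
      \<longlonglongrightarrow> L d * g p False + L (lcm d p) * (g p True - g p False)"
    using insert.prems pos by (intro tendsto_intros lim) auto
  also have "L d * g p False + L (lcm d p) * (g p True - g p False) =
      L d * (u * g p True + (1 - u) * g p False)"
    by (simp add: L_lcm algebra_simps)
  also have "\<dots> = 1 / real d * (\<Prod>p\<in>insert p P. let u = (if p dvd d then 1 else 1 / real p) in u * g p True + (1 - u) * g p False)"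
    using insert.hyps by (simp add: L_def u_def Let_def)
  finally show ?case
    by (simp only: split[symmetric] add_divide_distrib times_divide_eq_left)
qed

section \<open>Pattern densities for finitely many primes\<close>

text \<open>The probability that a random subset of \<open>I\<close>, containing each \<open>i\<close> independently with
  probability \<open>u i\<close>, belongs to \<open>F\<close>.\<close>

definition pattern_weight :: "'i set \<Rightarrow> 'i set set \<Rightarrow> ('i \<Rightarrow> real) \<Rightarrow> real" where
  "pattern_weight I F u = (\<Sum>S\<in>F. \<Prod>i\<in>I. if i \<in> S then u i else 1 - u i)"

text \<open>Choosing a pattern \<open>\<sigma> p\<close> in \<open>F\<close> for every prime turns
  the indicator into a sum of products over the coordinates. For fixed \<open>\<sigma>\<close> the
  sum over tuples factors into averages over one coordinate, whose limits are known. After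
  exchanging the products over \<open>I\<close> and \<open>P\<close>, the sum over
  \<open>\<sigma>\<close> collapses by distributivity to one weight per prime.\<close>

lemma tendsto_pattern_density_finite:
  fixes D :: "'i \<Rightarrow> nat"
  assumes "finite I" "F \<subseteq> Pow I" "finite P" "\<And>p. p \<in> P \<Longrightarrow> prime p"
    and "\<And>i. i \<in> I \<Longrightarrow> D i > 0"
  shows "(\<lambda>n. real (card {x \<in> I \<rightarrow>\<^sub>E {1..n}. (\<forall>i\<in>I. D i dvd x i) \<and> (\<forall>p\<in>P. {i\<in>I. p dvd x i} \<in> F)})
      / real n ^ card I) \<longlonglongrightarrow>
    (\<Prod>i\<in>I. 1 / real (D i)) * (\<Prod>p\<in>P. pattern_weight I F (\<lambda>i. if p dvd D i then 1 else 1 / real p))"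
proof -
  have finF: "finite F"
    using assms by (meson finite_Pow_iff finite_subset)
  define h :: "'i set \<Rightarrow> 'i \<Rightarrow> bool \<Rightarrow> real" where "h S i b = (if i \<in> S then of_bool b else of_bool (\<not> b))" for S i b
  define u where "u i p = (if p dvd D i then 1 else 1 / real p)" for i p
  let ?Q = "\<lambda>x. (\<forall>i\<in>I. D i dvd x i) \<and> (\<forall>p\<in>P. {i\<in>I. p dvd x i} \<in> F)"
  \<comment> \<open>At most one \<open>\<sigma>\<close> contributes: the factors \<open>h\<close>
    force \<open>\<sigma> p\<close> to be the actual pattern \<open>{i\<in>I. p dvd x i}\<close>,
    which is available exactly if it belongs to \<open>F\<close>.\<close>
  have ind: "(\<Sum>\<sigma>\<in>P \<rightarrow>\<^sub>E F. \<Prod>i\<in>I. of_bool (D i dvd x i) * (\<Prod>p\<in>P. h (\<sigma> p) i (p dvd x i))) = of_bool (?Q x)" for x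
  proof -
    have pat: "(\<Sum>S\<in>F. \<Prod>i\<in>I. h S i (p dvd x i)) = of_bool ({i\<in>I. p dvd x i} \<in> F)" for p
    proof -
      have "(\<Prod>i\<in>I. h S i (p dvd x i)) = of_bool (S = {i\<in>I. p dvd x i})" if "S \<in> F" for S
      proof -
        have "(\<Prod>i\<in>I. h S i (p dvd x i)) = (\<Prod>i\<in>I. of_bool (i \<in> S \<longleftrightarrow> p dvd x i))"
          by (intro prod.cong) (auto simp: h_def)
        also have "\<dots> = of_bool (S = {i\<in>I. p dvd x i})"
        proof -
          \<comment> \<open>The product tests only indices in \<open>I\<close>, so equality of the
            sets also uses \<open>S \<subseteq> I\<close>, a consequence of
            \<open>F \<subseteq> Pow I\<close>.\<close>
          have "(\<forall>i\<in>I. i \<in> S \<longleftrightarrow> p dvd x i) \<longleftrightarrow> S = {i\<in>I. p dvd x i}"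
            using that assms(2) by blast
          then show ?thesis
            by (simp only: prod_of_bool[OF assms(1)])
        qed
        finally show ?thesis .
      qed
      then have "(\<Sum>S\<in>F. \<Prod>i\<in>I. h S i (p dvd x i)) = (\<Sum>S\<in>F. of_bool (S = {i\<in>I. p dvd x i}))"
        by (intro sum.cong) auto
      also have "\<dots> = of_bool ({i\<in>I. p dvd x i} \<in> F)"
        using finF by (simp add: of_bool_def)
      finally show ?thesis .
    qed
    have "(\<Sum>\<sigma>\<in>P \<rightarrow>\<^sub>E F. \<Prod>i\<in>I. of_bool (D i dvd x i) * (\<Prod>p\<in>P. h (\<sigma> p) i (p dvd x i))) =
       of_bool (\<forall>i\<in>I. D i dvd x i) * (\<Sum>\<sigma>\<in>P \<rightarrow>\<^sub>E F. \<Prod>p\<in>P. \<Prod>i\<in>I. h (\<sigma> p) i (p dvd x i))"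
      unfolding prod.distrib sum_distrib_left[symmetric] prod_of_bool[OF assms(1)]
      by (subst prod.swap) simp
    also have "(\<Sum>\<sigma>\<in>P \<rightarrow>\<^sub>E F. \<Prod>p\<in>P. \<Prod>i\<in>I. h (\<sigma> p) i (p dvd x i)) = (\<Prod>p\<in>P. \<Sum>S\<in>F. \<Prod>i\<in>I. h S i (p dvd x i))"
      using assms finF by (subst prod_sum_PiE) auto
    also have "\<dots> = of_bool (\<forall>p\<in>P. {i\<in>I. p dvd x i} \<in> F)"
      unfolding pat using assms by (subst prod_of_bool) auto
    finally show ?thesis by simp
  qed
  have count: "real (card {x \<in> I \<rightarrow>\<^sub>E {1..n}. ?Q x}) / real n ^ card I =
     (\<Sum>\<sigma>\<in>P \<rightarrow>\<^sub>E F. \<Prod>i\<in>I. (\<Sum>y=1..n. of_bool (D i dvd y) * (\<Prod>p\<in>P. h (\<sigma> p) i (p dvd y))) / real n)" for n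
  proof -
    have "real (card {x \<in> I \<rightarrow>\<^sub>E {1..n}. ?Q x}) = (\<Sum>x\<in>I \<rightarrow>\<^sub>E {1..n}. of_bool (?Q x))"
      using assms(1) by (subst sum_of_bool_eq) (auto intro!: finite_PiE arg_cong[of _ _ card])
    also have "\<dots> = (\<Sum>x\<in>I \<rightarrow>\<^sub>E {1..n}. \<Sum>\<sigma>\<in>P \<rightarrow>\<^sub>E F. \<Prod>i\<in>I. of_bool (D i dvd x i) * (\<Prod>p\<in>P. h (\<sigma> p) i (p dvd x i)))"
      by (simp only: ind)
    also have "\<dots> = (\<Sum>\<sigma>\<in>P \<rightarrow>\<^sub>E F. \<Sum>x\<in>I \<rightarrow>\<^sub>E {1..n}. \<Prod>i\<in>I. of_bool (D i dvd x i) * (\<Prod>p\<in>P. h (\<sigma> p) i (p dvd x i)))"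
      by (rule sum.swap)
    also have "\<dots> = (\<Sum>\<sigma>\<in>P \<rightarrow>\<^sub>E F. \<Prod>i\<in>I. \<Sum>y=1..n. of_bool (D i dvd y) * (\<Prod>p\<in>P. h (\<sigma> p) i (p dvd y)))"
      using assms(1) by (intro sum.cong refl, subst prod_sum_PiE) auto
    finally show ?thesis
      by (simp only: prod_dividef sum_divide_distrib[where A = "P \<rightarrow>\<^sub>E F"] prod_constant)
  qed
  have "(\<lambda>n. \<Sum>\<sigma>\<in>P \<rightarrow>\<^sub>E F. \<Prod>i\<in>I. (\<Sum>y=1..n. of_bool (D i dvd y) * (\<Prod>p\<in>P. h (\<sigma> p) i (p dvd y))) / real n)
     \<longlonglongrightarrow> (\<Sum>\<sigma>\<in>P \<rightarrow>\<^sub>E F. \<Prod>i\<in>I. 1 / real (D i) * (\<Prod>p\<in>P. let u = (if p dvd D i then 1 else 1 / real p)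
        in u * h (\<sigma> p) i True + (1 - u) * h (\<sigma> p) i False))"
    using assms by (intro tendsto_sum tendsto_prod tendsto_average_multiples_prod) auto
  also have "(\<Sum>\<sigma>\<in>P \<rightarrow>\<^sub>E F. \<Prod>i\<in>I. 1 / real (D i) * (\<Prod>p\<in>P. let u = (if p dvd D i then 1 else 1 / real p)
        in u * h (\<sigma> p) i True + (1 - u) * h (\<sigma> p) i False)) =
      (\<Sum>\<sigma>\<in>P \<rightarrow>\<^sub>E F. (\<Prod>i\<in>I. 1 / real (D i)) * (\<Prod>i\<in>I. \<Prod>p\<in>P. if i \<in> \<sigma> p then u i p else 1 - u i p))"
    unfolding prod.distrib
    by (intro sum.cong arg_cong2[where f = "(*)"] prod.cong refl) (auto simp: h_def u_def)
  also have "\<dots> = (\<Prod>i\<in>I. 1 / real (D i)) * (\<Sum>\<sigma>\<in>P \<rightarrow>\<^sub>E F. \<Prod>p\<in>P. \<Prod>i\<in>I. if i \<in> \<sigma> p then u i p else 1 - u i p)"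
    unfolding sum_distrib_left[symmetric] by (subst prod.swap) simp
  also have "(\<Sum>\<sigma>\<in>P \<rightarrow>\<^sub>E F. \<Prod>p\<in>P. \<Prod>i\<in>I. if i \<in> \<sigma> p then u i p else 1 - u i p) =
      (\<Prod>p\<in>P. pattern_weight I F (\<lambda>i. u i p))"
    unfolding pattern_weight_def using assms finF by (subst prod_sum_PiE) auto
  finally show ?thesis
    by (simp only: count u_def)
qed

section \<open>From probabilities to counting\<close>

text \<open>The event splits into the disjoint events \<open>E x\<close> on which the tuple equals
  \<open>x\<close>, and by independence each \<open>x\<close> in the box has the same probability.
  The variables lie in \<open>{1..n}\<close> only almost surely, so tuples outside the box are
  discarded by an almost everywhere equality.\<close>

lemma (in prob_space) prob_uniform_tuple:
  fixes X :: "'i \<Rightarrow> 'a \<Rightarrow> nat"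
  assumes indep: "indep_vars (\<lambda>_. count_space UNIV) X I"
    and I: "finite I" "I \<noteq> {}" and n: "n > 0"
    and unif: "\<And>i. i \<in> I \<Longrightarrow> distr M (count_space UNIV) (X i) = measure_pmf (pmf_of_set {1..n})"
  shows "prob {\<omega> \<in> space M. (\<lambda>i\<in>I. X i \<omega>) \<in> A} =
    real (card {x \<in> I \<rightarrow>\<^sub>E {1..n}. x \<in> A}) / real n ^ card I"
proof -
  have meas: "random_variable (count_space UNIV) (X i)" if "i \<in> I" for i
    using indep that by (auto simp: indep_vars_def)
  have marginal: "prob (X i -` B \<inter> space M) = measure (measure_pmf (pmf_of_set {1..n})) B" if "i \<in> I" for i B
    using measure_distr[OF meas[OF that], of B] unif[OF that] by simp
  \<comment> \<open>Since \<open>I\<close> is nonempty, the intersection stays inside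
    \<open>space M\<close>.\<close>
  define E where "E x = (\<Inter>i\<in>I. X i -` {x i} \<inter> space M)" for x :: "'i \<Rightarrow> nat"
  have E_meas: "E x \<in> events" for x
    unfolding E_def using I meas by (intro sets.finite_INT) (auto intro: measurable_sets)
  have E_prob: "prob (E x) = 1 / real n ^ card I" if "x \<in> I \<rightarrow>\<^sub>E {1..n}" for x
  proof -
    have "prob (E x) = (\<Prod>i\<in>I. prob (X i -` {x i} \<inter> space M))"
      unfolding E_def using indep I by (intro indep_varsD_finite) auto
    also have "\<dots> = (\<Prod>i\<in>I. 1 / real n)"
      using that n by (intro prod.cong refl) (auto simp: marginal measure_pmf_single PiE_def Pi_def)
    finally show ?thesis
      by (simp add: power_one_over)
  qed
  have tuple_E: "(\<lambda>i\<in>I. X i \<omega>) = x \<longleftrightarrow> \<omega> \<in> E x" if "\<omega> \<in> space M" "x \<in> extensional I" for \<omega> x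
    using that I by (auto simp: E_def fun_eq_iff extensional_def)
  have set_eq: "{\<omega> \<in> space M. (\<lambda>i\<in>I. X i \<omega>) \<in> B} = (\<Union>x\<in>B \<inter> (I \<rightarrow>\<^sub>E UNIV). E x)" for B
  proof (intro set_eqI iffI)
    fix \<omega> assume "\<omega> \<in> {\<omega> \<in> space M. (\<lambda>i\<in>I. X i \<omega>) \<in> B}"
    then show "\<omega> \<in> (\<Union>x\<in>B \<inter> (I \<rightarrow>\<^sub>E UNIV). E x)"
      using tuple_E[of \<omega> "\<lambda>i\<in>I. X i \<omega>"] by (intro UN_I[of "\<lambda>i\<in>I. X i \<omega>"]) auto
  next
    fix \<omega> assume "\<omega> \<in> (\<Union>x\<in>B \<inter> (I \<rightarrow>\<^sub>E UNIV). E x)"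
    then obtain x where x: "x \<in> B" "x \<in> extensional I" "\<omega> \<in> E x"
      by (auto simp: PiE_def)
    moreover from x have "\<omega> \<in> space M"
      using I by (auto simp: E_def)
    ultimately show "\<omega> \<in> {\<omega> \<in> space M. (\<lambda>i\<in>I. X i \<omega>) \<in> B}"
      using tuple_E[of \<omega> x] by simp
  qed
  \<comment> \<open>As \<open>I\<close> is finite, there are only countably many tuples of natural
    numbers, so every \<open>B\<close> yields an event.\<close>
  have tuple_meas: "{\<omega> \<in> space M. (\<lambda>i\<in>I. X i \<omega>) \<in> B} \<in> events" for B
  proof -
    have "countable (B \<inter> (I \<rightarrow>\<^sub>E UNIV))"
      using I by (intro countable_Int2 countable_PiE) auto
    then show ?thesis
      unfolding set_eq using E_meas by (intro sets.countable_UN') auto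
  qed
  have range: "AE \<omega> in M. \<forall>i\<in>I. X i \<omega> \<in> {1..n}"
  proof (rule AE_finite_allI[OF I(1)])
    fix i assume i: "i \<in> I"
    have "prob (X i -` {1..n} \<inter> space M) = 1"
      using n i by (simp add: marginal measure_pmf_of_set)
    then have "AE \<omega> in M. \<omega> \<in> X i -` {1..n} \<inter> space M"
      using i meas by (subst (asm) prob_eq_1) (auto intro: measurable_sets)
    then show "AE \<omega> in M. X i \<omega> \<in> {1..n}"
      by eventually_elim auto
  qed
  let ?A = "{x \<in> I \<rightarrow>\<^sub>E {1..n}. x \<in> A}"
  have "prob {\<omega> \<in> space M. (\<lambda>i\<in>I. X i \<omega>) \<in> A} = prob {\<omega> \<in> space M. (\<lambda>i\<in>I. X i \<omega>) \<in> ?A}"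
  proof (rule finite_measure_eq_AE)
    show "AE \<omega> in M. (\<omega> \<in> {\<omega> \<in> space M. (\<lambda>i\<in>I. X i \<omega>) \<in> A}) = (\<omega> \<in> {\<omega> \<in> space M. (\<lambda>i\<in>I. X i \<omega>) \<in> ?A})"
      using range by eventually_elim auto
  qed (rule tuple_meas)+
  also have "{\<omega> \<in> space M. (\<lambda>i\<in>I. X i \<omega>) \<in> ?A} = (\<Union>x\<in>?A. E x)"
    unfolding set_eq by (intro arg_cong[of _ _ Union] arg_cong[of _ _ "(`) E"]) (auto simp: PiE_def)
  also have "prob (\<Union>x\<in>?A. E x) = (\<Sum>x\<in>?A. prob (E x))"
  proof (rule finite_measure_finite_Union)
    show "finite ?A"
      using I by (intro finite_subset[OF _ finite_PiE[of I "\<lambda>_. {1..n}"]]) auto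
    show "disjoint_family_on E ?A"
      unfolding disjoint_family_on_def
    proof (intro ballI impI)
      fix x y assume xy: "x \<in> ?A" "y \<in> ?A" "x \<noteq> y"
      then obtain i where "i \<in> I" "x i \<noteq> y i"
        by (metis (no_types, lifting) PiE_ext mem_Collect_eq)
      then show "E x \<inter> E y = {}"
        by (auto simp: E_def)
    qed
  qed (use E_meas in auto)
  also have "\<dots> = (\<Sum>x\<in>?A. 1 / real n ^ card I)"
    by (intro sum.cong E_prob) auto
  also have "\<dots> = real (card ?A) / real n ^ card I"
    by simp
  finally show ?thesis .
qed

section \<open>Passage from finitely many primes to all primes\<close>

text \<open>Telescoping with \<open>1 / m ^ 2 \<le> 1 / (m - 1) - 1 / m\<close>; for
  \<open>n < N\<close> the sum is empty.\<close>

lemma sum_inverse_squares_tail: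
  assumes "N > 0"
  shows "(\<Sum>m=Suc N..n. 1 / real m ^ 2) \<le> 1 / real N"
proof -
  have "(\<Sum>m=Suc N..n. 1 / real m ^ 2) \<le> 1 / real N - 1 / real n" if "n \<ge> N"
    using that
  proof (induction n rule: dec_induct)
    case (step n)
    have "1 / real (Suc n) ^ 2 \<le> 1 / real n - 1 / real (Suc n)"
      using assms step by (simp add: divide_simps power2_eq_square)
    with step show ?case
      by simp
  qed simp
  then have "(\<Sum>m=Suc N..n. 1 / real m ^ 2) \<le> 1 / real N" if "n \<ge> N"
    by (rule order_trans[of _ "1 / real N - 1 / real n"]) (use that in simp_all)
  then show ?thesis
    by (cases "n \<ge> N") auto
qed

text \<open>The tuples form a box in which the coordinates \<open>i\<close> and \<open>j\<close>
  have \<open>n div m \<le> n / m\<close> choices each and every other coordinate has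
  \<open>n\<close>.\<close>

lemma density_common_multiple_le:
  assumes I: "finite I" "i \<in> I" "j \<in> I" "i \<noteq> j" and m: "m > 0"
  shows "real (card {x \<in> I \<rightarrow>\<^sub>E {1..n}. m dvd x i \<and> m dvd x j}) / real n ^ card I \<le> 1 / real m ^ 2"
proof (cases "n = 0")
  \<comment> \<open>Here \<open>card I > 0\<close>, so the denominator vanishes and the quotient is
    0 by convention.\<close>
  case True
  then show ?thesis
    using I by (cases "card I") auto
next
  case False
  define B where "B k = (if k \<in> {i, j} then {y \<in> {1..n}. m dvd y} else {1..n})" for k
  have "{x \<in> I \<rightarrow>\<^sub>E {1..n}. m dvd x i \<and> m dvd x j} = (\<Pi>\<^sub>E k\<in>I. B k)"
    using I by (auto simp: B_def PiE_iff extensional_def split: if_splits)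
  then have "real (card {x \<in> I \<rightarrow>\<^sub>E {1..n}. m dvd x i \<and> m dvd x j}) / real n ^ card I =
      (\<Prod>k\<in>I. real (card (B k)) / real n)"
    using I by (simp add: card_PiE prod_dividef)
  also have "\<dots> \<le> (\<Prod>k\<in>I. if k \<in> {i, j} then 1 / real m else 1)"
  proof (intro prod_mono conjI)
    fix k assume "k \<in> I"
    have "real (n div m) / real n \<le> (real n / real m) / real n"
      by (intro divide_right_mono of_nat_div_le_of_nat) simp
    then show "real (card (B k)) / real n \<le> (if k \<in> {i, j} then 1 / real m else 1)"
      using False m card_multiples[of m n] by (auto simp: B_def)
  qed simp
  also have "\<dots> = (\<Prod>k\<in>{i, j}. 1 / real m)"
    using I by (simp only: prod.inter_restrict[symmetric] Int_absorb1 insert_subset empty_subsetI simp_thms)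
  also have "\<dots> = 1 / real m ^ 2"
    using I by (simp add: power2_eq_square)
  finally show ?thesis .
qed

text \<open>An exchange of limits: \<open>e N\<close> bounds the error uniformly in
  \<open>n\<close>, so \<open>N\<close> can be fixed before \<open>n\<close>, with
  \<open>\<epsilon> / 3\<close> for each of three errors. The bound is asked for
  \<open>N > 0\<close> only, because it will be a multiple of \<open>1 / N\<close>, which is 0 by
  convention at \<open>N = 0\<close>.\<close>

lemma tendsto_approx:
  fixes f :: "nat \<Rightarrow> real"
  assumes lim: "\<And>N. (\<lambda>n. g N n) \<longlonglongrightarrow> G N" and G: "G \<longlonglongrightarrow> L"
    and e: "e \<longlonglongrightarrow> 0" and bound: "\<And>N n. N > 0 \<Longrightarrow> \<bar>g N n - f n\<bar> \<le> e N"
  shows "f \<longlonglongrightarrow> L"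
proof (rule LIMSEQ_I)
  fix \<epsilon> :: real assume \<epsilon>: "\<epsilon> > 0"
  have "\<forall>\<^sub>F N in sequentially. \<bar>G N - L\<bar> < \<epsilon> / 3"
    using tendstoD[OF G, of "\<epsilon> / 3"] \<epsilon> by (simp add: dist_real_def)
  moreover have "\<forall>\<^sub>F N in sequentially. \<bar>e N\<bar> < \<epsilon> / 3"
    using tendstoD[OF e, of "\<epsilon> / 3"] \<epsilon> by (simp add: dist_real_def)
  ultimately have "\<forall>\<^sub>F N in sequentially. \<bar>G N - L\<bar> < \<epsilon> / 3 \<and> \<bar>e N\<bar> < \<epsilon> / 3 \<and> N > 0"
    using eventually_gt_at_top[of 0] by eventually_elim auto
  then obtain N where N: "\<bar>G N - L\<bar> < \<epsilon> / 3" "\<bar>e N\<bar> < \<epsilon> / 3" "N > 0"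
    by (auto simp: eventually_sequentially)
  have "\<forall>\<^sub>F n in sequentially. \<bar>g N n - G N\<bar> < \<epsilon> / 3"
    using tendstoD[OF lim, of "\<epsilon> / 3"] \<epsilon> by (simp add: dist_real_def)
  then have "\<forall>\<^sub>F n in sequentially. norm (f n - L) < \<epsilon>"
  proof eventually_elim
    case (elim n)
    then show ?case
      using N bound[of N n] unfolding real_norm_def by linarith
  qed
  then show "\<exists>n0. \<forall>n\<ge>n0. norm (f n - L) < \<epsilon>"
    by (simp add: eventually_sequentially)
qed

lemma tendsto_pattern_density:
  fixes D :: "'i \<Rightarrow> nat"
  assumes I: "finite I" and F: "F \<subseteq> Pow I" "\<And>S. S \<subseteq> I \<Longrightarrow> card S \<le> 1 \<Longrightarrow> S \<in> F"
    and D: "\<And>i. i \<in> I \<Longrightarrow> D i > 0"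
    and L: "(\<lambda>N. \<Prod>p | prime p \<and> p \<le> N. pattern_weight I F (\<lambda>i. if p dvd D i then 1 else 1 / real p)) \<longlonglongrightarrow> L"
  shows "(\<lambda>n. real (card {x \<in> I \<rightarrow>\<^sub>E {1..n}. (\<forall>i\<in>I. D i dvd x i) \<and> (\<forall>p. prime p \<longrightarrow> {i\<in>I. p dvd x i} \<in> F)})
      / real n ^ card I) \<longlonglongrightarrow> (\<Prod>i\<in>I. 1 / real (D i)) * L"
proof (rule tendsto_approx)
  let ?P = "\<lambda>N::nat. {p. prime p \<and> p \<le> N}"
  let ?A = "\<lambda>N n. {x \<in> I \<rightarrow>\<^sub>E {1..n}. (\<forall>i\<in>I. D i dvd x i) \<and> (\<forall>p\<in>?P N. {i\<in>I. p dvd x i} \<in> F)}"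
  let ?B = "\<lambda>n. {x \<in> I \<rightarrow>\<^sub>E {1..n}. (\<forall>i\<in>I. D i dvd x i) \<and> (\<forall>p. prime p \<longrightarrow> {i\<in>I. p dvd x i} \<in> F)}"
  have finP: "finite (?P N)" for N
    by (rule finite_subset[of _ "{..N}"]) auto
  show "(\<lambda>n. real (card (?A N n)) / real n ^ card I) \<longlonglongrightarrow>
     (\<Prod>i\<in>I. 1 / real (D i)) * (\<Prod>p\<in>?P N. pattern_weight I F (\<lambda>i. if p dvd D i then 1 else 1 / real p))" for N
    using I F(1) finP D by (intro tendsto_pattern_density_finite) auto
  show "(\<lambda>N. (\<Prod>i\<in>I. 1 / real (D i)) * (\<Prod>p\<in>?P N. pattern_weight I F (\<lambda>i. if p dvd D i then 1 else 1 / real p)))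
     \<longlonglongrightarrow> (\<Prod>i\<in>I. 1 / real (D i)) * L"
    by (intro tendsto_intros L)
  let ?J = "{(i, j) \<in> I \<times> I. i \<noteq> j}"
  show "(\<lambda>N. real (card ?J) * (1 / real N)) \<longlonglongrightarrow> 0"
    by (intro tendsto_mult_right_zero lim_1_over_n)
  show "\<bar>real (card (?A N n)) / real n ^ card I - real (card (?B n)) / real n ^ card I\<bar> \<le> real (card ?J) * (1 / real N)"
    if N: "N > 0" for N n
  proof -
    let ?C = "\<lambda>m (i, j). {x \<in> I \<rightarrow>\<^sub>E {1..n}. m dvd x i \<and> m dvd x j}"
    have finJ: "finite ?J"
      using I by (auto intro: finite_subset[of _ "I \<times> I"])
    have fin: "finite (I \<rightarrow>\<^sub>E {1..n})"
      using I by (intro finite_PiE) auto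
    have finC: "finite (?C m ij)" for m ij
      using fin by (cases ij) auto
    \<comment> \<open>The union runs over all integers \<open>m\<close> in
      \<open>{Suc N..n}\<close>, not only primes, to fit the telescoping tail bound. The upper end
      \<open>n\<close> suffices because \<open>p\<close> divides a positive coordinate that is at
      most \<open>n\<close>.\<close>
    have sub: "?A N n \<subseteq> ?B n \<union> (\<Union>ij\<in>?J. \<Union>m\<in>{Suc N..n}. ?C m ij)"
    proof
      fix x assume x: "x \<in> ?A N n"
      show "x \<in> ?B n \<union> (\<Union>ij\<in>?J. \<Union>m\<in>{Suc N..n}. ?C m ij)"
      proof (cases "x \<in> ?B n")
        case False
        moreover have "x \<in> I \<rightarrow>\<^sub>E {1..n}" "\<forall>i\<in>I. D i dvd x i"
          using x by simp_all
        ultimately have "\<not> (\<forall>p. prime p \<longrightarrow> {i\<in>I. p dvd x i} \<in> F)"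
          by simp
        then obtain p where p: "prime p" "{i\<in>I. p dvd x i} \<notin> F"
          by meson
        have "p > N"
        proof (rule ccontr)
          assume "\<not> p > N"
          then have "p \<in> ?P N"
            using p by simp
          moreover have "\<forall>p\<in>?P N. {i\<in>I. p dvd x i} \<in> F"
            using x by simp
          ultimately show False
            using p(2) by blast
        qed
        have "\<not> card {i\<in>I. p dvd x i} \<le> Suc 0"
          using p F(2)[of "{i\<in>I. p dvd x i}"] by auto
        then obtain i j where ij: "i \<in> I" "j \<in> I" "p dvd x i" "p dvd x j" "i \<noteq> j"
          using I by (subst (asm) card_le_Suc0_iff_eq) auto
        have "x i \<in> {1..n}"
          using x ij by auto
        then have "p \<le> n"
          using ij(3) dvd_imp_le[of p "x i"] by auto
        then show ?thesis
          using ij x \<open>p > N\<close> by (intro UnI2 UN_I[of "(i, j)"] UN_I[of p]) auto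
      qed auto
    qed
    have "real (card (?A N n)) \<le> real (card (?B n \<union> (\<Union>ij\<in>?J. \<Union>m\<in>{Suc N..n}. ?C m ij)))"
    proof (intro of_nat_mono card_mono sub finite_UnI finite_UN_I)
      show "finite (?B n)"
        by (rule finite_subset[OF _ fin]) blast
    qed (use finJ finC in simp_all)
    also have "\<dots> \<le> real (card (?B n) + (\<Sum>ij\<in>?J. \<Sum>m=Suc N..n. card (?C m ij)))"
    proof (rule of_nat_mono)
      have "card (\<Union>ij\<in>?J. \<Union>m\<in>{Suc N..n}. ?C m ij) \<le> (\<Sum>ij\<in>?J. card (\<Union>m\<in>{Suc N..n}. ?C m ij))"
        using finJ by (rule card_UN_le)
      also have "\<dots> \<le> (\<Sum>ij\<in>?J. \<Sum>m=Suc N..n. card (?C m ij))"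
        by (intro sum_mono card_UN_le) simp
      finally show "card (?B n \<union> (\<Union>ij\<in>?J. \<Union>m\<in>{Suc N..n}. ?C m ij)) \<le>
          card (?B n) + (\<Sum>ij\<in>?J. \<Sum>m=Suc N..n. card (?C m ij))"
        using card_Un_le[of "?B n" "\<Union>ij\<in>?J. \<Union>m\<in>{Suc N..n}. ?C m ij"] by linarith
    qed
    finally have "real (card (?A N n)) - real (card (?B n)) \<le> (\<Sum>ij\<in>?J. \<Sum>m=Suc N..n. real (card (?C m ij)))"
      by simp
    then have "(real (card (?A N n)) - real (card (?B n))) / real n ^ card I \<le>
        (\<Sum>ij\<in>?J. \<Sum>m=Suc N..n. real (card (?C m ij))) / real n ^ card I"
      by (rule divide_right_mono) simp
    also have "\<dots> = (\<Sum>ij\<in>?J. \<Sum>m=Suc N..n. real (card (?C m ij)) / real n ^ card I)"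
      by (simp add: sum_divide_distrib)
    also have "\<dots> \<le> (\<Sum>ij\<in>?J. \<Sum>m=Suc N..n. 1 / real m ^ 2)"
    proof (intro sum_mono)
      fix ij m assume "ij \<in> ?J" "m \<in> {Suc N..n}"
      then show "real (card (?C m ij)) / real n ^ card I \<le> 1 / real m ^ 2"
        using I by (cases ij) (simp only: split_conv, intro density_common_multiple_le, auto)
    qed
    also have "\<dots> \<le> (\<Sum>ij\<in>?J. 1 / real N)"
      using sum_inverse_squares_tail[OF N] by (intro sum_mono) auto
    finally have "(real (card (?A N n)) - real (card (?B n))) / real n ^ card I \<le> real (card ?J) * (1 / real N)"
      by simp
    moreover have "real (card (?B n)) \<le> real (card (?A N n))"
    proof (intro of_nat_mono card_mono)
      show "finite (?A N n)"
        by (rule finite_subset[OF _ fin]) blast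
    qed blast
    ultimately show ?thesis
      by (simp add: diff_divide_distrib[symmetric] abs_of_nonneg divide_nonneg_nonneg)
  qed
qed

section \<open>The Euler product of the zeta function\<close>

lemma summable_on_powr:
  assumes "s > 1"
  shows "(\<lambda>m::nat. real m powr -s) summable_on A"
proof -
  have "summable (\<lambda>m. norm (real m powr -s))"
    using assms by (simp add: summable_real_powr_iff)
  then have "(\<lambda>m::nat. real m powr -s) summable_on UNIV"
    by (rule norm_summable_imp_summable_on)
  then show ?thesis
    by (rule summable_on_subset_banach) auto
qed

text \<open>Unordered sums suit the sieve below, which splits and rescales the index set.\<close>

lemma zeta_eq_infsum:
  assumes "s > 1"
  shows "zeta s = (\<Sum>\<^sub>\<infinity>m\<in>{0<..}. real m powr -s)"
proof -
  have "zeta s = (\<Sum>n. real (Suc n) powr -s)"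
    by (simp add: zeta_def powr_minus_divide)
  also have "\<dots> = (\<Sum>\<^sub>\<infinity>n. real (Suc n) powr -s)"
  proof (rule infsumI[OF norm_summable_imp_has_sum, symmetric])
    show "summable (\<lambda>n. norm (real (Suc n) powr -s))"
      using summable_zeta[OF assms] by (simp add: powr_minus_divide)
    show "(\<lambda>n. real (Suc n) powr -s) sums (\<Sum>n. real (Suc n) powr -s)"
      using summable_zeta[OF assms] by (intro summable_sums) (simp add: powr_minus_divide)
  qed
  also have "\<dots> = (\<Sum>\<^sub>\<infinity>m\<in>{0<..}. real m powr -s)"
    by (rule infsum_reindex_bij_betw[where f = "\<lambda>m. real m powr -s"])
      (auto simp: bij_betw_def image_iff gr0_conv_Suc)
  finally show ?thesis .
qed

text \<open>Sieve of Eratosthenes: among the integers that survive \<open>P\<close>, the multiples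
  of a new prime \<open>p\<close> are \<open>p\<close> times the survivors, so they carry the
  fraction \<open>p powr -s\<close> of the sum, and removing them multiplies it by
  \<open>1 - p powr -s\<close>.\<close>

lemma euler_product_sieve:
  assumes s: "s > 1" and "finite P" "\<And>p. p \<in> P \<Longrightarrow> prime p"
  shows "(\<Prod>p\<in>P. 1 - real p powr -s) * zeta s =
    (\<Sum>\<^sub>\<infinity>m | m > 0 \<and> (\<forall>p\<in>P. \<not> p dvd m). real m powr -s)"
  using assms(2,3)
proof (induction P rule: finite_induct)
  case empty
  then show ?case
    using zeta_eq_infsum[OF s] by (simp add: greaterThan_def)
next
  case (insert p P)
  let ?f = "\<lambda>m::nat. real m powr -s"
  define A where "A = {m. m > 0 \<and> (\<forall>q\<in>P. \<not> q dvd m)}"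
  define B where "B = {m. m > 0 \<and> (\<forall>q\<in>insert p P. \<not> q dvd m)}"
  have p: "prime p" "p > 0"
    using insert.prems prime_gt_0_nat by auto
  \<comment> \<open>Multiplication by \<open>p\<close> preserves survival because no prime in
    \<open>P\<close> divides \<open>p\<close>.\<close>
  have A_eq: "A = B \<union> (\<lambda>m. p * m) ` A"
  proof
    show "A \<subseteq> B \<union> (\<lambda>m. p * m) ` A"
    proof
      fix m assume m: "m \<in> A"
      show "m \<in> B \<union> (\<lambda>m. p * m) ` A"
      proof (cases "p dvd m")
        case True
        then obtain k where "m = p * k" ..
        with m have "k \<in> A"
          by (auto simp: A_def)
        with \<open>m = p * k\<close> show ?thesis by auto
      qed (use m in \<open>auto simp: A_def B_def\<close>)
    qed
    have "\<not> q dvd p" if "q \<in> P" for q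
      using that p insert primes_dvd_imp_eq[of q p] by auto
    then show "B \<union> (\<lambda>m. p * m) ` A \<subseteq> A"
      using p insert by (auto simp: A_def B_def prime_dvd_mult_iff)
  qed
  have "infsum ?f A = infsum ?f B + infsum ?f ((\<lambda>m. p * m) ` A)"
  proof (subst A_eq, rule infsum_Un_disjoint)
    show "B \<inter> (\<lambda>m. p * m) ` A = {}"
      by (auto simp: B_def)
  qed (intro summable_on_powr s)+
  also have "infsum ?f ((\<lambda>m. p * m) ` A) = (\<Sum>\<^sub>\<infinity>m\<in>A. real p powr -s * ?f m)"
    using p by (subst infsum_reindex) (auto simp: inj_on_def o_def powr_mult)
  also have "\<dots> = real p powr -s * infsum ?f A"
    by (rule infsum_cmult_right')
  finally have "infsum ?f B = (1 - real p powr -s) * infsum ?f A"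
    by (simp add: algebra_simps)
  then show ?case
    using insert by (simp add: A_def B_def mult.assoc)
qed

text \<open>An integer without prime factors up to \<open>N\<close> is 1 or exceeds
  \<open>N\<close>, so the sieved sum lies between 1 and 1 plus a tail of the zeta series, and tends
  to 1.\<close>

lemma euler_product:
  assumes s: "s > 1"
  shows "(\<lambda>N. \<Prod>p | prime p \<and> p \<le> N. 1 - real p powr -s) \<longlonglongrightarrow> 1 / zeta s"
proof -
  let ?f = "\<lambda>m::nat. real m powr -s"
  let ?P = "\<lambda>N::nat. {p. prime p \<and> p \<le> N}"
  let ?A = "\<lambda>N. {m. m > 0 \<and> (\<forall>p\<in>?P N. \<not> p dvd m)}"
  have finP: "finite (?P N)" for N
    by (rule finite_subset[of _ "{..N}"]) auto
  have sieve: "(\<Prod>p\<in>?P N. 1 - real p powr -s) * zeta s = infsum ?f (?A N)" for N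
    using finP by (intro euler_product_sieve s) auto
  have lower: "1 \<le> infsum ?f (?A N)" for N
  proof -
    have "infsum ?f {1} \<le> infsum ?f (?A N)"
      by (intro infsum_mono2 summable_on_powr s) auto
    then show ?thesis by simp
  qed
  have upper: "infsum ?f (?A N) \<le> 1 + (zeta s - (\<Sum>m=1..N. ?f m))" if "N > 0" for N
  proof -
    have small: "m = 1" if "m \<in> ?A N" "m \<le> N" for m
    proof (rule ccontr)
      assume "m \<noteq> 1"
      then obtain p where "prime p" "p dvd m"
        using prime_factor_nat by blast
      then show False
        using that dvd_imp_le[of p m] by auto
    qed
    have le: "infsum ?f (?A N) \<le> infsum ?f ({1} \<union> {N<..})"
    proof (rule infsum_mono2)
      show "?A N \<subseteq> {1} \<union> {N<..}"
        using small by force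
    qed (auto intro: summable_on_powr s)
    \<comment> \<open>Disjointness of \<open>{1}\<close> and \<open>{N<..}\<close> is where
      \<open>N > 0\<close> is used.\<close>
    have split: "infsum ?f ({1} \<union> {N<..}) = 1 + infsum ?f {N<..}"
      using that by (subst infsum_Un_disjoint) (auto intro: summable_on_powr s)
    have "zeta s = infsum ?f ({1..N} \<union> {N<..})"
      unfolding zeta_eq_infsum[OF s] by (intro arg_cong[of _ _ "infsum ?f"]) auto
    then have "zeta s = (\<Sum>m=1..N. ?f m) + infsum ?f {N<..}"
      by (subst (asm) infsum_Un_disjoint) (auto intro: summable_on_powr s)
    with le split show ?thesis
      by simp
  qed
  have "(\<lambda>N. \<Sum>m<N. ?f (Suc m)) \<longlonglongrightarrow> zeta s"
    using summable_LIMSEQ[OF summable_zeta[OF s]] by (simp add: zeta_def powr_minus_divide)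
  also have "(\<lambda>N. \<Sum>m<N. ?f (Suc m)) = (\<lambda>N. \<Sum>m=1..N. ?f m)"
    by (simp add: sum.atLeast1_atMost_eq)
  finally have "(\<lambda>N. 1 + (zeta s - (\<Sum>m=1..N. ?f m))) \<longlonglongrightarrow> 1 + (zeta s - zeta s)"
    by (intro tendsto_intros)
  then have upper_lim: "(\<lambda>N. 1 + (zeta s - (\<Sum>m=1..N. ?f m))) \<longlonglongrightarrow> 1"
    by simp
  have "(\<lambda>N. infsum ?f (?A N)) \<longlonglongrightarrow> 1"
  proof (rule tendsto_sandwich[OF _ _ tendsto_const upper_lim])
    show "\<forall>\<^sub>F N in sequentially. 1 \<le> infsum ?f (?A N)"
      by (rule always_eventually[OF allI]) (rule lower)
    show "\<forall>\<^sub>F N in sequentially. infsum ?f (?A N) \<le> 1 + (zeta s - (\<Sum>m=1..N. ?f m))"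
      by (rule eventually_sequentiallyI[of 1], rule upper) simp
  qed
  \<comment> \<open>At \<open>N = 0\<close> nothing is sieved out, so the lower bound reads
    \<open>1 \<le> zeta s\<close>.\<close>
  moreover have "zeta s \<noteq> 0"
    using lower[of 0] sieve[of 0] by auto
  ultimately have "(\<lambda>N. infsum ?f (?A N) / zeta s) \<longlonglongrightarrow> 1 / zeta s"
    by (intro tendsto_intros)
  moreover have "(\<Prod>p\<in>?P N. 1 - real p powr -s) = infsum ?f (?A N) / zeta s" for N
    using sieve[of N] \<open>zeta s \<noteq> 0\<close> by (simp add: field_simps)
  ultimately show ?thesis
    by simp
qed

section \<open>Weights of the two families of patterns\<close>

lemma pattern_weight_cong:
  assumes "\<And>i. i \<in> I \<Longrightarrow> u i = v i"
  shows "pattern_weight I F u = pattern_weight I F v"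
  unfolding pattern_weight_def using assms by (intro sum.cong prod.cong) auto

text \<open>The family consists of \<open>{}\<close>, which gives the first summand, and the
  singletons \<open>{k}\<close>, which give the sum.\<close>

lemma pattern_weight_at_most_one:
  assumes "finite I"
  shows "pattern_weight I {S. S \<subseteq> I \<and> card S \<le> 1} u =
    (\<Prod>i\<in>I. 1 - u i) + (\<Sum>k\<in>I. u k * (\<Prod>i\<in>I - {k}. 1 - u i))"
proof -
  let ?w = "\<lambda>S. \<Prod>i\<in>I. if i \<in> S then u i else 1 - u i"
  have eq: "{S. S \<subseteq> I \<and> card S \<le> 1} = insert {} ((\<lambda>k. {k}) ` I)"
  proof -
    have "S = {} \<or> (\<exists>k\<in>I. S = {k})" if "S \<subseteq> I" "card S \<le> 1" for S
    proof (cases "card S")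
      case 0
      then show ?thesis
        using that assms by (auto dest: finite_subset)
    next
      case (Suc m)
      then have "card S = 1"
        using that by simp
      then show ?thesis
        using that by (auto simp: card_1_singleton_iff)
    qed
    then show ?thesis
      by auto
  qed
  have "?w {k} = u k * (\<Prod>i\<in>I - {k}. 1 - u i)" if "k \<in> I" for k
    using assms that by (subst prod.remove[of I k]) (auto intro!: prod.cong)
  then have "sum ?w ((\<lambda>k. {k}) ` I) = (\<Sum>k\<in>I. u k * (\<Prod>i\<in>I - {k}. 1 - u i))"
    by (subst sum.reindex) (auto simp: o_def intro!: sum.cong)
  then show ?thesis
    unfolding pattern_weight_def eq using assms by (subst sum.insert) auto
qed

text \<open>Expanding the product of \<open>u i + (1 - u i) = 1\<close> shows that all subsets
  together have weight 1; the weight of \<open>I\<close> itself is subtracted.\<close>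

lemma pattern_weight_proper:
  assumes "finite I"
  shows "pattern_weight I (Pow I - {I}) u = 1 - (\<Prod>i\<in>I. u i)"
proof -
  let ?w = "\<lambda>S. \<Prod>i\<in>I. if i \<in> S then u i else 1 - u i"
  have "(\<Sum>S\<in>Pow I. ?w S) = (\<Sum>S\<in>Pow I. (\<Prod>i\<in>S. u i) * (\<Prod>i\<in>I - S. 1 - u i))"
    using assms by (intro sum.cong refl) (auto simp: prod.If_cases Int_absorb1 Diff_eq)
  also have "\<dots> = (\<Prod>i\<in>I. u i + (1 - u i))"
    using assms by (rule prod_add[symmetric])
  also have "\<dots> = 1"
    by simp
  finally show ?thesis
    using assms by (simp add: pattern_weight_def sum_diff)
qed

section \<open>Limits of products over primes\<close>

text \<open>Every prime factor of \<open>m\<close> is at most \<open>m\<close>, so from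
  \<open>N = m\<close> on the correction is the constant product of \<open>h\<close> over
  \<open>prime_factors m\<close>.\<close>

lemma tendsto_prod_primes_modified:
  fixes f h w :: "nat \<Rightarrow> real"
  assumes lim: "(\<lambda>N. \<Prod>p | prime p \<and> p \<le> N. f p) \<longlonglongrightarrow> L" and "m > 0"
    and w: "\<And>p. prime p \<Longrightarrow> w p = f p * (if p dvd m then h p else 1)"
  shows "(\<lambda>N. \<Prod>p | prime p \<and> p \<le> N. w p) \<longlonglongrightarrow> L * (\<Prod>p\<in>prime_factors m. h p)"
proof (rule Lim_transform_eventually)
  show "(\<lambda>N. (\<Prod>p | prime p \<and> p \<le> N. f p) * (\<Prod>p\<in>prime_factors m. h p)) \<longlonglongrightarrow>
      L * (\<Prod>p\<in>prime_factors m. h p)"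
    by (intro tendsto_intros lim)
  have "(\<Prod>p | prime p \<and> p \<le> N. w p) = (\<Prod>p | prime p \<and> p \<le> N. f p) * (\<Prod>p\<in>prime_factors m. h p)"
    if N: "N \<ge> m" for N
  proof -
    have fin: "finite {p. prime p \<and> p \<le> N}"
      by (rule finite_subset[of _ "{..N}"]) auto
    have eq: "{p. prime p \<and> p \<le> N} \<inter> {p. p dvd m} = prime_factors m"
      using N \<open>m > 0\<close> by (auto simp: prime_factors_dvd dest: dvd_imp_le)
    have "(\<Prod>p | prime p \<and> p \<le> N. w p) =
        (\<Prod>p | prime p \<and> p \<le> N. f p) * (\<Prod>p | prime p \<and> p \<le> N. if p dvd m then h p else 1)"
      unfolding prod.distrib[symmetric] using w by (intro prod.cong) auto
    then show ?thesis
      using fin by (simp add: prod.If_cases eq)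
  qed
  then show "\<forall>\<^sub>F N in sequentially. (\<Prod>p | prime p \<and> p \<le> N. f p) * (\<Prod>p\<in>prime_factors m. h p) =
      (\<Prod>p | prime p \<and> p \<le> N. w p)"
    by (intro eventually_sequentiallyI[of m]) simp
qed

text \<open>The partial products run over \<open>{..N}\<close>, where the factors 1 at the
  non-primes drop out.\<close>

lemma T_const_LIMSEQ:
  "(\<lambda>N. \<Prod>p | prime p \<and> p \<le> N. (1 - 1 / real p) ^ r + real r / real p * (1 - 1 / real p) ^ (r - 1))
     \<longlonglongrightarrow> T_const r"
proof -
  have eq: "{p. prime p \<and> p \<le> N} = {p \<in> {..N}. prime p}" for N :: nat
    by auto
  show ?thesis
    using convergent_prod_LIMSEQ[OF convergent_prod_T_const[of r]]
    by (simp only: T_const_def eq prod.inter_filter finite_atMost)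
qed

section \<open>Coprimality as a local condition, and its local factors\<close>

text \<open>A gcd differs from 1 exactly if some prime divides both numbers, that is, if two
  distinct indices lie in the pattern of one prime.\<close>

lemma pairwise_coprime_tuples_iff:
  assumes "x \<in> {1..r} \<rightarrow>\<^sub>E {0<..}"
  shows "x \<in> pairwise_coprime_tuples r a \<longleftrightarrow> (\<forall>i\<in>{1..r}. a i dvd x i) \<and>
    (\<forall>p. prime p \<longrightarrow> {i\<in>{1..r}. p dvd x i} \<in> {S. S \<subseteq> {1..r} \<and> card S \<le> 1})"
proof -
  have "gcd (x i) (x j) = 1 \<longleftrightarrow> (\<forall>p. prime p \<longrightarrow> \<not> (p dvd x i \<and> p dvd x j))" for i j
    by (metis gcd_greatest_iff not_prime_unit prime_factor_nat)
  then have "(\<forall>i\<in>{1..r}. \<forall>j\<in>{1..r}. i \<noteq> j \<longrightarrow> gcd (x i) (x j) = 1) \<longleftrightarrow>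
      (\<forall>p. prime p \<longrightarrow> (\<forall>i\<in>{i\<in>{1..r}. p dvd x i}. \<forall>j\<in>{i\<in>{1..r}. p dvd x i}. i = j))"
    by blast
  also have "\<dots> \<longleftrightarrow> (\<forall>p. prime p \<longrightarrow> card {i\<in>{1..r}. p dvd x i} \<le> 1)"
    by (subst One_nat_def, subst card_le_Suc0_iff_eq) auto
  finally show ?thesis
    using assms by (auto simp: pairwise_coprime_tuples_def)
qed

text \<open>The gcd of all coordinates differs from 1 exactly if some prime divides every
  coordinate, that is, has the full pattern.\<close>

lemma coprime_tuples_iff:
  assumes "x \<in> {1..r} \<rightarrow>\<^sub>E {0<..}"
  shows "x \<in> coprime_tuples r a \<longleftrightarrow> (\<forall>i\<in>{1..r}. a i dvd x i) \<and>
    (\<forall>p. prime p \<longrightarrow> {i\<in>{1..r}. p dvd x i} \<in> Pow {1..r} - {{1..r}})"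
proof -
  have "Gcd (x ` {1..r}) = 1 \<longleftrightarrow> (\<forall>p. prime p \<longrightarrow> \<not> p dvd Gcd (x ` {1..r}))"
    by (metis not_prime_unit prime_factor_nat)
  also have "\<dots> \<longleftrightarrow> (\<forall>p. prime p \<longrightarrow> {i\<in>{1..r}. p dvd x i} \<noteq> {1..r})"
    unfolding dvd_Gcd_iff by blast
  finally show ?thesis
    using assms by (auto simp: coprime_tuples_def)
qed

text \<open>By coprimality, a prime dividing the product divides exactly one \<open>a k\<close>.
  Coordinate \<open>k\<close> is then always a multiple of \<open>p\<close>, and only the pattern
  \<open>{k}\<close> keeps a nonzero weight, \<open>(1 - 1 / p) ^ (r - 1)\<close>. Its ratio to the
  generic weight is the local factor of \<open>Psi\<close> inverted.\<close>

lemma pattern_weight_pairwise_coprime: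
  assumes r: "r \<ge> 1" and p: "prime p"
    and coprime: "\<And>i j. i \<in> {1..r} \<Longrightarrow> j \<in> {1..r} \<Longrightarrow> i \<noteq> j \<Longrightarrow> gcd (a i) (a j) = 1"
  shows "pattern_weight {1..r} {S. S \<subseteq> {1..r} \<and> card S \<le> 1} (\<lambda>i. if p dvd a i then 1 else 1 / real p) =
    ((1 - 1 / real p) ^ r + real r / real p * (1 - 1 / real p) ^ (r - 1)) *
    (if p dvd (\<Prod>i\<in>{1..r}. a i) then 1 / (1 + of_int (int r - 1) / real p) else 1)"
proof (cases "p dvd (\<Prod>i\<in>{1..r}. a i)")
  case False
  then have "\<not> p dvd a i" if "i \<in> {1..r}" for i
    using that by (meson dvd_prod_eqI dvd_trans dvd_prodI finite_atLeastAtMost)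
  then have "pattern_weight {1..r} {S. S \<subseteq> {1..r} \<and> card S \<le> 1} (\<lambda>i. if p dvd a i then 1 else 1 / real p) =
      pattern_weight {1..r} {S. S \<subseteq> {1..r} \<and> card S \<le> 1} (\<lambda>_. 1 / real p)"
    by (intro pattern_weight_cong) simp
  also have "\<dots> = (1 - 1 / real p) ^ r + real r / real p * (1 - 1 / real p) ^ (r - 1)"
    by (subst pattern_weight_at_most_one) simp_all
  finally show ?thesis
    using False by simp
next
  case True
  then obtain k where k: "k \<in> {1..r}" "p dvd a k"
    using p by (auto simp: prime_dvd_prod_iff)
  let ?u = "\<lambda>i. if p dvd a i then 1 else 1 / real p"
  have other: "\<not> p dvd a i" if "i \<in> {1..r} - {k}" for i
    using that k p coprime[of i k] by (metis DiffE gcd_greatest not_prime_unit singletonI)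
  \<comment> \<open>The factor at \<open>k\<close> is \<open>1 - 1 = 0\<close>; it removes the empty
    pattern here and the singletons other than \<open>{k}\<close> next.\<close>
  have "(\<Prod>i\<in>{1..r}. 1 - ?u i) = 0"
    using k by (intro prod_zero) auto
  moreover have "(\<Sum>l\<in>{1..r} - {k}. ?u l * (\<Prod>i\<in>{1..r} - {l}. 1 - ?u i)) = 0"
  proof (intro sum.neutral ballI)
    fix l assume "l \<in> {1..r} - {k}"
    then have "(\<Prod>i\<in>{1..r} - {l}. 1 - ?u i) = 0"
      using k by (intro prod_zero) auto
    then show "?u l * (\<Prod>i\<in>{1..r} - {l}. 1 - ?u i) = 0"
      by simp
  qed
  moreover have "(\<Prod>i\<in>{1..r} - {k}. 1 - ?u i) = (\<Prod>i\<in>{1..r} - {k}. 1 - 1 / real p)"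
    by (rule prod.cong) (use other in simp_all)
  then have "(\<Prod>i\<in>{1..r} - {k}. 1 - ?u i) = (1 - 1 / real p) ^ (r - 1)"
    using k by simp
  ultimately have "pattern_weight {1..r} {S. S \<subseteq> {1..r} \<and> card S \<le> 1} ?u = (1 - 1 / real p) ^ (r - 1)"
    using k by (subst pattern_weight_at_most_one) (simp_all add: sum.remove[of _ k])
  \<comment> \<open>With \<open>h = 1 / p\<close> this is
    \<open>(1 - h) + r * h = 1 + (r - 1) * h\<close>, after extracting the common power.\<close>
  moreover have "(1 - 1 / real p) ^ r + real r / real p * (1 - 1 / real p) ^ (r - 1) =
      (1 - 1 / real p) ^ (r - 1) * (1 + of_int (int r - 1) / real p)"
    using r by (cases r) (auto simp: algebra_simps diff_divide_distrib add_divide_distrib)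
  moreover have "1 + of_int (int r - 1) / real p > 0"
    using r by (intro add_pos_nonneg divide_nonneg_nonneg) auto
  ultimately show ?thesis
    using True by simp
qed

text \<open>The weight is 1 minus the probability that \<open>p\<close> divides all coordinates.
  That probability is \<open>p\<close> to the power \<open>-r\<close> generically, but
  \<open>-(r - 1)\<close> if one coordinate is divisible by \<open>p\<close> for sure. The generic
  factor is written with \<open>powr\<close> to match the Euler product.\<close>

lemma pattern_weight_coprime:
  assumes r: "r \<ge> 1" and p: "prime p"
    and coprime: "\<And>i j. i \<in> {1..r} \<Longrightarrow> j \<in> {1..r} \<Longrightarrow> i \<noteq> j \<Longrightarrow> gcd (a i) (a j) = 1"
  shows "pattern_weight {1..r} (Pow {1..r} - {{1..r}}) (\<lambda>i. if p dvd a i then 1 else 1 / real p) =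
    (1 - real p powr -real r) *
    (if p dvd (\<Prod>i\<in>{1..r}. a i) then (1 - 1 / real p ^ (r - 1)) / (1 - 1 / real p ^ r) else 1)"
proof (cases "p dvd (\<Prod>i\<in>{1..r}. a i)")
  case False
  then have "\<not> p dvd a i" if "i \<in> {1..r}" for i
    using that by (meson dvd_prod_eqI dvd_trans dvd_prodI finite_atLeastAtMost)
  then have "pattern_weight {1..r} (Pow {1..r} - {{1..r}}) (\<lambda>i. if p dvd a i then 1 else 1 / real p) =
      pattern_weight {1..r} (Pow {1..r} - {{1..r}}) (\<lambda>_. 1 / real p)"
    by (intro pattern_weight_cong) simp
  also have "\<dots> = 1 - real p powr -real r"
    using prime_gt_0_nat[OF p] by (simp add: pattern_weight_proper powr_minus powr_realpow field_simps)
  finally show ?thesis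
    using False by simp
next
  case True
  then obtain k where k: "k \<in> {1..r}" "p dvd a k"
    using p by (auto simp: prime_dvd_prod_iff)
  have other: "\<not> p dvd a i" if "i \<in> {1..r} - {k}" for i
    using that k p coprime[of i k] by (metis DiffE gcd_greatest not_prime_unit singletonI)
  let ?u = "\<lambda>i. if p dvd a i then 1 else 1 / real p"
  have "(\<Prod>i\<in>{1..r}. ?u i) = (\<Prod>i\<in>{1..r} - {k}. ?u i)"
    using k by (subst prod.remove[of _ k]) simp_all
  also have "\<dots> = (\<Prod>i\<in>{1..r} - {k}. 1 / real p)"
    by (rule prod.cong) (use other in simp_all)
  also have "\<dots> = (1 / real p) ^ (r - 1)"
    using k by simp
  finally have "pattern_weight {1..r} (Pow {1..r} - {{1..r}}) (\<lambda>i. if p dvd a i then 1 else 1 / real p) =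
      1 - 1 / real p ^ (r - 1)"
    by (simp add: pattern_weight_proper power_one_over)
  \<comment> \<open>This keeps the denominator \<open>1 - 1 / p ^ r\<close> away from 0, so that it
    cancels.\<close>
  moreover have "real p ^ r > 1"
    using prime_gt_1_nat[OF p] r by simp
  moreover have "real p powr -real r = 1 / real p ^ r"
    using prime_gt_0_nat[OF p] by (simp add: powr_minus powr_realpow divide_inverse)
  ultimately show ?thesis
    using True by simp
qed

section \<open>Limits of the two probabilities\<close>

theorem theorem3p4:
  fixes r :: nat and a :: "nat \<Rightarrow> nat"
    and M :: "nat \<Rightarrow> 'w measure" and X :: "nat \<Rightarrow> nat \<Rightarrow> 'w \<Rightarrow> nat"
  assumes "r \<ge> 2"
    and "\<And>i. i \<in> {1..r} \<Longrightarrow> a i > 0"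
    and "\<And>i j. i \<in> {1..r} \<Longrightarrow> j \<in> {1..r} \<Longrightarrow> i \<noteq> j \<Longrightarrow> gcd (a i) (a j) = 1"
    and "\<And>n. n \<ge> 2 \<Longrightarrow> prob_space (M n)"
    and "\<And>n. n \<ge> 2 \<Longrightarrow>
           prob_space.indep_vars (M n) (\<lambda>_. count_space UNIV) (X n) {1..r}"
    and "\<And>n j. n \<ge> 2 \<Longrightarrow> j \<in> {1..r} \<Longrightarrow>
           distr (M n) (count_space UNIV) (X n j) = measure_pmf (pmf_of_set {1..n})"
  shows "((\<lambda>n. \<P>(\<omega> in M n. (\<lambda>j\<in>{1..r}. X n j \<omega>) \<in> pairwise_coprime_tuples r a))
            \<longlonglongrightarrow> T_const r * (1 / Psi (int r - 1) (\<Prod>i\<in>{1..r}. a i))) \<and>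
         ((\<lambda>n. \<P>(\<omega> in M n. (\<lambda>j\<in>{1..r}. X n j \<omega>) \<in> coprime_tuples r a))
            \<longlonglongrightarrow> 1 / zeta (real r) *
              (jordan_totient (r - 1) (\<Prod>i\<in>{1..r}. a i) /
               jordan_totient r (\<Prod>i\<in>{1..r}. a i)))"
proof -
  define A where "A = (\<Prod>i\<in>{1..r}. a i)"
  have A: "A > 0"
    unfolding A_def using assms(2) by (intro prod_pos) auto
  have A_inverse: "(\<Prod>i\<in>{1..r}. 1 / real (a i)) = 1 / real A"
    by (simp add: A_def prod_dividef)
  have w_pairwise: "pattern_weight {1..r} {S. S \<subseteq> {1..r} \<and> card S \<le> 1} (\<lambda>i. if p dvd a i then 1 else 1 / real p) =
      ((1 - 1 / real p) ^ r + real r / real p * (1 - 1 / real p) ^ (r - 1)) *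
      (if p dvd A then 1 / (1 + of_int (int r - 1) / real p) else 1)" if "prime p" for p
    unfolding A_def by (rule pattern_weight_pairwise_coprime[OF _ that assms(3)]) (use assms(1) in simp_all)
  have w_coprime: "pattern_weight {1..r} (Pow {1..r} - {{1..r}}) (\<lambda>i. if p dvd a i then 1 else 1 / real p) =
      (1 - real p powr -real r) *
      (if p dvd A then (1 - 1 / real p ^ (r - 1)) / (1 - 1 / real p ^ r) else 1)" if "prime p" for p
    unfolding A_def by (rule pattern_weight_coprime[OF _ that assms(3)]) (use assms(1) in simp_all)
  \<comment> \<open>Both limits are instances: \<open>F\<close> encodes the coprimality condition,
    \<open>f\<close> is the generic local factor with product \<open>L\<close>, and \<open>h\<close>
    corrects it at the primes dividing \<open>A\<close>. The divisibilities themselves contribute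
    the density \<open>1 / A\<close>.\<close>
  have limit: "(\<lambda>n. \<P>(\<omega> in M n. (\<lambda>j\<in>{1..r}. X n j \<omega>) \<in> C)) \<longlonglongrightarrow> L'"
    if F: "F \<subseteq> Pow {1..r}" "\<And>S. S \<subseteq> {1..r} \<Longrightarrow> card S \<le> 1 \<Longrightarrow> S \<in> F"
      and C: "\<And>x. x \<in> {1..r} \<rightarrow>\<^sub>E {0<..} \<Longrightarrow> x \<in> C \<longleftrightarrow>
        (\<forall>i\<in>{1..r}. a i dvd x i) \<and> (\<forall>p. prime p \<longrightarrow> {i\<in>{1..r}. p dvd x i} \<in> F)"
      and f: "(\<lambda>N. \<Prod>p | prime p \<and> p \<le> N. f p) \<longlonglongrightarrow> L"
      and w: "\<And>p. prime p \<Longrightarrow> pattern_weight {1..r} F (\<lambda>i. if p dvd a i then 1 else 1 / real p) =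
        f p * (if p dvd A then h p else 1)"
      and L': "L' = 1 / real A * (L * (\<Prod>p\<in>prime_factors A. h p))"
    for C :: "(nat \<Rightarrow> nat) set" and F L L' f h
  proof (rule Lim_transform_eventually)
    let ?B = "\<lambda>n. {x \<in> {1..r} \<rightarrow>\<^sub>E {1..n}. (\<forall>i\<in>{1..r}. a i dvd x i) \<and>
      (\<forall>p. prime p \<longrightarrow> {i\<in>{1..r}. p dvd x i} \<in> F)}"
    show "(\<lambda>n. real (card (?B n)) / real n ^ card {1..r}) \<longlonglongrightarrow> L'"
      unfolding L' A_inverse[symmetric] using F assms(2)
      by (intro tendsto_pattern_density tendsto_prod_primes_modified[OF f A w]) auto
    have "\<P>(\<omega> in M n. (\<lambda>j\<in>{1..r}. X n j \<omega>) \<in> C) = real (card (?B n)) / real n ^ card {1..r}"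
      if n: "n \<ge> 2" for n
    proof -
      have "x \<in> {1..r} \<rightarrow>\<^sub>E {0<..}" if "x \<in> {1..r} \<rightarrow>\<^sub>E {1..n}" for x
        using that by (rule subsetD[OF PiE_mono, rotated]) auto
      then have "{x \<in> {1..r} \<rightarrow>\<^sub>E {1..n}. x \<in> C} = ?B n"
        using C by (intro Collect_cong conj_cong) auto
      then show ?thesis
        using prob_space.prob_uniform_tuple[OF assms(4)[OF n] assms(5)[OF n], of n C] assms(1,6) n
        by simp
    qed
    \<comment> \<open>The distribution of \<open>X n\<close> is prescribed only for
      \<open>n \<ge> 2\<close>, which an eventual equality accommodates.\<close>
    then show "\<forall>\<^sub>F n in sequentially. real (card (?B n)) / real n ^ card {1..r} =
        \<P>(\<omega> in M n. (\<lambda>j\<in>{1..r}. X n j \<omega>) \<in> C)"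
      by (intro eventually_sequentiallyI[of 2]) simp
  qed
  show ?thesis
    unfolding A_def[symmetric]
  proof
    show "(\<lambda>n. \<P>(\<omega> in M n. (\<lambda>j\<in>{1..r}. X n j \<omega>) \<in> pairwise_coprime_tuples r a))
        \<longlonglongrightarrow> T_const r * (1 / Psi (int r - 1) A)"
    proof (rule limit[OF _ _ pairwise_coprime_tuples_iff T_const_LIMSEQ w_pairwise])
      show "T_const r * (1 / Psi (int r - 1) A) =
          1 / real A * (T_const r * (\<Prod>p\<in>prime_factors A. 1 / (1 + of_int (int r - 1) / real p)))"
        by (simp add: Psi_def prod_dividef)
    qed (use assms(1) in auto)
    show "(\<lambda>n. \<P>(\<omega> in M n. (\<lambda>j\<in>{1..r}. X n j \<omega>) \<in> coprime_tuples r a))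
        \<longlonglongrightarrow> 1 / zeta (real r) * (jordan_totient (r - 1) A / jordan_totient r A)"
    \<comment> \<open>The bound \<open>r \<ge> 2\<close> serves twice: it makes sets with at most
      one element proper subsets of \<open>{1..r}\<close>, and it gives the exponent above 1 that
      the Euler product requires.\<close>
    proof (rule limit[OF _ _ coprime_tuples_iff euler_product w_coprime])
      \<comment> \<open>The leading powers in the quotient of the two totients leave
        \<open>1 / A\<close>, which matches the density of the divisibilities.\<close>
      have "real A ^ r = real A * real A ^ (r - 1)"
        using assms(1) by (cases r) auto
      then show "1 / zeta (real r) * (jordan_totient (r - 1) A / jordan_totient r A) =
          1 / real A * (1 / zeta (real r) *
            (\<Prod>p\<in>prime_factors A. (1 - 1 / real p ^ (r - 1)) / (1 - 1 / real p ^ r)))"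
        using A by (simp add: jordan_totient_def prod_dividef)
    qed (use assms(1) in auto)
  qed
qed

end
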